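(* For each real number $x>0$ there exists an integer $N$ such that for every integer $n\ge N$ (with $n \geq 1$) the polynomial in $t$ $$\mathcal{A}\left(\left(1+\frac{xt}{n}\right)^n\right)$$ fails to be real-rooted, i.e. it has at least one non-real zero.
   Context: For $n\ge 0$, the $n$-th Eulerian polynomial is $A_n(t)=\sum_{k=0}^n A_{nk}t^k$, where $A_{nk}$ is the number of permutations $\sigma$ of $\{1,\dots,n\}$ such that $\sigma(i)\ge i$ for exactly $k$ indices $i$. In particular $A_0(t)=1$, $A_1(t)=t$, $A_2(t)=t+t^2$, $A_3(t)=t+4t^2+t^3$. The map $\mathcal{A}:\mathbb{R}[t]\to\mathbb{R}[t]$ is the $\mathbb{R}$-linear operator determined by $\mathcal{A}(t^n)=A_n(t)$ for all $n\ge 0$. *)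

theory Defs
  imports
    Complex_Main
    "HOL-Combinatorics.Permutations"
    "HOL-Computational_Algebra.Polynomial"
begin

definition eulerian_number :: "nat \<Rightarrow> nat \<Rightarrow> nat" where
  "eulerian_number n k =
     card {\<sigma>. \<sigma> permutes {1..n} \<and> card {i \<in> {1..n}. \<sigma> i \<ge> i} = k}"

definition eulerian_poly :: "nat \<Rightarrow> real poly" where
  "eulerian_poly n = (\<Sum>k\<le>n. monom (real (eulerian_number n k)) k)"

text \<open>
  The linear operator on real polynomials that sends \<open>t ^ n\<close> to the \<open>n\<close>-th Eulerian polynomial;
  \<open>eulerian_op_unique\<close> below shows that linearity and the values on monomials determine it.
\<close>
definition eulerian_op :: "real poly \<Rightarrow> real poly" where
  "eulerian_op p = (\<Sum>i\<le>degree p. smult (coeff p i) (eulerian_poly i))"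

definition real_rooted :: "real poly \<Rightarrow> bool" where
  "real_rooted p \<longleftrightarrow> (\<forall>z::complex. poly (map_poly complex_of_real p) z = 0 \<longrightarrow> z \<in> \<real>)"

lemma eulerian_op_altdef:
  assumes "degree p \<le> m"
  shows "eulerian_op p = (\<Sum>i\<le>m. smult (coeff p i) (eulerian_poly i))"
  unfolding eulerian_op_def
  by (rule sum.mono_neutral_left) (use assms in \<open>auto intro: coeff_eq_0\<close>)

lemma eulerian_op_add: "eulerian_op (p + q) = eulerian_op p + eulerian_op q"
proof -
  define m where "m = max (degree p) (degree q)"
  have "degree (p + q) \<le> m" "degree p \<le> m" "degree q \<le> m"
    unfolding m_def by (auto intro: degree_add_le_max)
  then show ?thesis
    by (simp add: eulerian_op_altdef smult_add_left sum.distrib)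
qed

lemma smult_sum_distrib: "smult c (sum f A) = (\<Sum>i\<in>A. smult c (f i))"
  by (induction A rule: infinite_finite_induct) (auto simp: smult_add_right)

lemma eulerian_op_smult: "eulerian_op (smult c p) = smult c (eulerian_op p)"
  by (simp add: eulerian_op_altdef[of "smult c p" "degree p"] eulerian_op_def smult_sum_distrib)

lemma eulerian_op_monom: "eulerian_op (monom 1 n) = eulerian_poly n"
proof -
  have "eulerian_op (monom 1 n) = (\<Sum>i\<le>n. smult (coeff (monom 1 n) i) (eulerian_poly i))"
    by (rule eulerian_op_altdef) (simp add: degree_monom_eq)
  also have "\<dots> = (\<Sum>i\<le>n. if i = n then eulerian_poly i else 0)"
    by (rule sum.cong) auto
  finally show ?thesis by simp
qed

lemma eulerian_op_unique:
  assumes add: "\<And>p q. L (p + q) = L p + L q"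
    and smult: "\<And>c p. L (smult c p) = smult c (L p)"
    and monom: "\<And>n. L (monom 1 n) = eulerian_poly n"
  shows "L = eulerian_op"
proof
  fix p :: "real poly"
  have L0: "L 0 = 0" using smult[of 0 0] by simp
  have L_sum: "L (sum f A) = (\<Sum>i\<in>A. L (f i))" for f and A :: "nat set"
    by (induction A rule: infinite_finite_induct) (auto simp: add L0)
  have "p = (\<Sum>i\<le>degree p. smult (coeff p i) (monom 1 i))"
    by (simp add: smult_monom poly_as_sum_of_monoms)
  then have "L p = (\<Sum>i\<le>degree p. L (smult (coeff p i) (monom 1 i)))"
    by (metis (no_types, lifting) L_sum sum.cong)
  then show "L p = eulerian_op p" by (simp add: smult monom eulerian_op_def)
qed

end

theory Submission
  imports Defs "HOL-Computational_Algebra.Fundamental_Theorem_Algebra"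
begin

text \<open>
  Write \<open>P\<^sub>n\<close> for the image of \<open>(1 + x t / n) ^ n\<close> and \<open>A\<^sub>j\<close> for the \<open>j\<close>-th Eulerian polynomial,
  so that \<open>P\<^sub>n = (\<Sum>j\<le>n. (n choose j) (x / n) ^ j A\<^sub>j)\<close>. As \<open>n\<close> grows, the coefficients of \<open>P\<^sub>n\<close>
  converge to those of \<open>\<Sum>j. x ^ j A\<^sub>j(t) / j! = (1 - t) / (1 - t exp (x (1 - t)))\<close>, which has a
  pole on the positive axis. Real-rooted polynomials with nonnegative coefficients and constant
  coefficient \<open>1\<close>, however, can only have entire limits. The proof makes this conflict quantitative
  at a single point.

  \<^item> Upper bound. If \<open>P\<^sub>n\<close> is real-rooted, then its roots are negative, because its coefficients are
    nonnegative and \<open>P\<^sub>n(0) = 1\<close>. So \<open>P\<^sub>n\<close> is a product of factors \<open>1 + a t\<close> with \<open>a > 0\<close>, and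
    \<open>1 + a t \<le> exp (a t)\<close> bounds \<open>P\<^sub>n(t)\<close> by \<open>exp (c t)\<close> for \<open>t \<ge> 0\<close>, where \<open>c\<close> is the linear
    coefficient (\<open>norm_poly_le_exp_if_roots_negative\<close>). At most one permutation of \<open>{1..j}\<close>
    has a single weak excedance (\<open>eulerian_number_1_le\<close>), hence
    \<open>c \<le> (1 + x / n) ^ n \<le> exp x\<close>, and the bound does not depend on \<open>n\<close>.

  \<^item> Lower bound. A permutation and its inverse together have at least \<open>j\<close> weak excedances, so the
    inequality of arithmetic and geometric means gives \<open>A\<^sub>j(s\<^sup>2) \<ge> j! s ^ j\<close> for \<open>s \<ge> 1\<close>
    (\<open>poly_eulerian_poly_ge\<close>). If moreover \<open>x s \<ge> 1\<close>, then \<open>P\<^sub>n(s\<^sup>2)\<close> is at least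
    \<open>\<Sum>j\<le>J. (n choose j) j! / n ^ j\<close> for each \<open>J \<le> n\<close>, and this sum tends to \<open>J + 1\<close>.

  Choosing \<open>J\<close> beyond the upper bound \<open>exp (s\<^sup>2 exp x)\<close> makes the two bounds incompatible for all
  large \<open>n\<close>.
\<close>

section \<open>Polynomials with negative roots\<close>

text \<open>
  The induction splits off one root \<open>z\<close> as a factor \<open>1 + a w\<close> with \<open>a = - 1 / z > 0\<close>. Multiplying by
  it adds \<open>a\<close> to the linear coefficient and multiplies the norm by at most \<open>1 + a |w| \<le> exp (a |w|)\<close>.
\<close>
lemma norm_poly_le_exp_if_roots_negative:
  fixes p :: "complex poly"
  assumes "coeff p 0 = 1"
    and "\<And>z. poly p z = 0 \<Longrightarrow> z \<in> \<real> \<and> Re z < 0"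
  shows "norm (poly p w) \<le> exp (norm w * Re (coeff p 1))"
  using assms
proof (induction "degree p" arbitrary: p)
  case 0
  then have "p = 1"
    by (metis degree_0_id lead_coeff_pCons(2) one_pCons coeff_pCons_0 degree_eq_zeroE)
  then show ?case by (simp add: one_pCons)
next
  case (Suc d)
  have "\<not> constant (poly p)"
    using Suc.hyps(2) by (simp add: constant_degree)
  then obtain z where z: "poly p z = 0"
    using fundamental_theorem_of_algebra by blast
  define a where "a = - 1 / Re z"
  have zR: "z = of_real (Re z)" and neg: "Re z < 0"
    using Suc.prems(2)[OF z] by auto
  have a: "a > 0" using neg by (simp add: a_def divide_neg_neg)
  have z0: "z \<noteq> 0" using neg by auto
  have az: "of_real a * z = - 1"
    by (subst zR) (use neg in \<open>simp add: a_def\<close>)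
  obtain q' where q': "p = [:- z, 1:] * q'"
    using z by (auto simp: poly_eq_0_iff_dvd)
  define q where "q = smult (- z) q'"
  have "[:1, of_real a:] * q = smult (- z) [:1, of_real a:] * q'"
    by (simp only: q_def mult_smult_left mult_smult_right)
  also have "smult (- z) [:1, of_real a:] = [:- z, 1:]"
    using az by (simp add: mult.commute)
  finally have p: "p = [:1, of_real a:] * q"
    using q' by simp
  have "p \<noteq> 0" using Suc.hyps(2) by auto
  then have "q \<noteq> 0" using p by auto
  have "degree p = degree [:1, complex_of_real a:] + degree q"
    unfolding p by (rule degree_mult_eq) (use \<open>q \<noteq> 0\<close> in auto)
  then have "d = degree q" using Suc.hyps(2) a by simp
  moreover have "coeff q 0 = 1" using Suc.prems(1) p by simp
  moreover have "u \<in> \<real> \<and> Re u < 0" if "poly q u = 0" for u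
    using Suc.prems(2)[of u] that p by simp
  ultimately have IH: "norm (poly q w) \<le> exp (norm w * Re (coeff q 1))"
    using Suc.hyps(1) by blast
  have c1: "Re (coeff p 1) = Re (coeff q 1) + a"
    unfolding p using \<open>coeff q 0 = 1\<close> by simp
  have "norm (1 + w * of_real a) \<le> 1 + norm w * a"
    using norm_triangle_ineq[of 1 "w * of_real a"] a by (simp add: norm_mult)
  also have "\<dots> \<le> exp (norm w * a)" by (rule exp_ge_add_one_self)
  finally have "norm (1 + w * of_real a) * norm (poly q w)
      \<le> exp (norm w * a) * exp (norm w * Re (coeff q 1))"
    using IH by (intro mult_mono) auto
  moreover have "poly p w = (1 + w * of_real a) * poly q w"
    unfolding p by (simp add: algebra_simps)
  ultimately have "norm (poly p w) \<le> exp (norm w * a) * exp (norm w * Re (coeff q 1))"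
    by (simp add: norm_mult)
  also have "\<dots> = exp (norm w * Re (coeff p 1))"
    unfolding c1 by (simp add: algebra_simps flip: exp_add)
  finally show ?case .
qed

lemma poly_map_poly_of_real:
  "poly (map_poly of_real p) (of_real t :: complex) = of_real (poly p t)"
  by (induction p) (auto simp: map_poly_pCons)

text \<open>
  Nonnegative coefficients exclude nonnegative roots, since the constant coefficient is \<open>1\<close>.
\<close>
lemma real_rooted_poly_le_exp:
  assumes rr: "real_rooted p" and c0: "coeff p 0 = 1" and nonneg: "\<And>k. coeff p k \<ge> 0"
    and t: "t \<ge> 0"
  shows "poly p t \<le> exp (t * coeff p 1)"
proof -
  let ?P = "map_poly complex_of_real p"
  have pos: "poly p r \<ge> 1" if "r \<ge> 0" for r
  proof -
    have "coeff p 0 * r ^ 0 \<le> (\<Sum>i\<le>degree p. coeff p i * r ^ i)"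
      by (rule member_le_sum) (use that nonneg in auto)
    then show ?thesis by (simp add: c0 poly_altdef)
  qed
  have "z \<in> \<real> \<and> Re z < 0" if z: "poly ?P z = 0" for z
  proof -
    have "z \<in> \<real>" using rr z by (auto simp: real_rooted_def)
    then obtain r where r: "z = of_real r" by (auto elim: Reals_cases)
    then have "poly p r = 0" using z by (simp add: poly_map_poly_of_real)
    then have "r < 0" using pos[of r] by force
    then show ?thesis using r by simp
  qed
  moreover have "coeff ?P 0 = 1" by (simp add: coeff_map_poly c0)
  ultimately have "norm (poly ?P (of_real t)) \<le> exp (norm (complex_of_real t) * Re (coeff ?P 1))"
    by (rule norm_poly_le_exp_if_roots_negative[rotated])
  then have "\<bar>poly p t\<bar> \<le> exp (t * coeff p 1)"
    using t by (simp add: poly_map_poly_of_real coeff_map_poly)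
  then show ?thesis by simp
qed

section \<open>Eulerian numbers and polynomials\<close>

lemma coeff_eulerian_poly:
  "coeff (eulerian_poly n) k = (if k \<le> n then real (eulerian_number n k) else 0)"
  by (simp add: eulerian_poly_def coeff_sum)

lemma eulerian_number_0: "eulerian_number n 0 = (if n = 0 then 1 else 0)"
proof (cases "n = 0")
  case True
  then show ?thesis by (simp add: eulerian_number_def)
next
  case False
  \<comment> \<open>The index 1 is a weak excedance of every permutation.\<close>
  have "card {i \<in> {1..n}. \<sigma> i \<ge> i} \<noteq> 0" if "\<sigma> permutes {1..n}" for \<sigma>
  proof -
    have "\<sigma> 1 \<ge> 1" using permutes_in_seg[OF that, of 1] False by simp
    then have "1 \<in> {i \<in> {1..n}. \<sigma> i \<ge> i}" using False by simp
    then show ?thesis by (auto simp: card_eq_0_iff)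
  qed
  then have "{\<sigma>. \<sigma> permutes {1..n} \<and> card {i \<in> {1..n}. \<sigma> i \<ge> i} = 0} = {}" by blast
  then show ?thesis using False by (simp only: eulerian_number_def card.empty if_False)
qed

text \<open>
  If \<open>1\<close> is the only weak excedance, then \<open>\<sigma> i < i\<close> for all other \<open>i\<close>, and injectivity forces
  \<open>\<sigma> 2 = 1\<close>, \<open>\<sigma> 3 = 2\<close>, and so on, so that \<open>\<sigma>\<close> is the \<open>n\<close>-cycle shifting every index down by one.
\<close>
lemma eulerian_number_1_le: "eulerian_number n 1 \<le> 1"
proof -
  define \<tau> where "\<tau> = (\<lambda>i. if i = 1 \<and> n \<ge> 1 then n else if i \<in> {2..n} then i - 1 else i)"
  have "\<sigma> = \<tau>" if perm: "\<sigma> permutes {1..n}" and card1: "card {i \<in> {1..n}. \<sigma> i \<ge> i} = 1" for \<sigma>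
  proof (cases "n = 0")
    case True
    then show ?thesis using perm by (auto simp: \<tau>_def)
  next
    case False
    have range: "1 \<le> \<sigma> i \<and> \<sigma> i \<le> n" if "1 \<le> i" "i \<le> n" for i
      using permutes_in_seg[OF perm, of i] that by simp
    have inj: "inj \<sigma>" by (rule permutes_inj[OF perm])
    obtain a where a: "{i \<in> {1..n}. \<sigma> i \<ge> i} = {a}"
      using card1 card_1_singletonE by blast
    have "1 \<in> {i \<in> {1..n}. \<sigma> i \<ge> i}" using range[of 1] False by simp
    then have a1: "{i \<in> {1..n}. \<sigma> i \<ge> i} = {1}" using a by auto
    have below: "\<sigma> i < i" if "2 \<le> i" "i \<le> n" for i
    proof (rule ccontr)
      assume "\<not> \<sigma> i < i"
      then have "i \<in> {i \<in> {1..n}. \<sigma> i \<ge> i}" using that by simp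
      then have "i \<in> {1}" unfolding a1 .
      then show False using that by simp
    qed
    have shift: "\<sigma> i = i - 1" if "2 \<le> i" "i \<le> n" for i
      using that
    proof (induction i rule: less_induct)
      case (less i)
      have le: "\<sigma> i < i" using below less.prems by blast
      show ?case
      proof (rule ccontr)
        assume ne: "\<sigma> i \<noteq> i - 1"
        define k where "k = \<sigma> i + 1"
        have k: "k < i" "2 \<le> k" using le ne range[of i] less.prems by (auto simp: k_def)
        then have "\<sigma> k = \<sigma> i" using less.IH[of k] less.prems by (simp add: k_def)
        then show False using inj k by (auto dest: injD)
      qed
    qed
    have first: "\<sigma> 1 = n"
    proof (rule ccontr)
      assume ne: "\<sigma> 1 \<noteq> n"
      define k where "k = \<sigma> 1 + 1"
      have "1 \<le> \<sigma> 1" "\<sigma> 1 \<le> n" using range[of 1] False by simp_all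
      then have k: "2 \<le> k" "k \<le> n" using ne unfolding k_def by linarith+
      then have "\<sigma> k = \<sigma> 1" using shift[OF k] unfolding k_def by simp
      then have "k = 1" by (rule injD[OF inj])
      then show False using k by simp
    qed
    show ?thesis
    proof
      fix i
      consider "i = 1" | "i \<in> {2..n}" | "i \<notin> {1..n}"
        unfolding atLeastAtMost_iff by linarith
      then show "\<sigma> i = \<tau> i"
      proof cases
        case 1
        then show ?thesis using first False by (simp add: \<tau>_def)
      next
        case 2
        then show ?thesis using shift[of i] by (simp add: \<tau>_def)
      next
        case 3
        then show ?thesis using permutes_not_in[OF perm 3] False by (auto simp: \<tau>_def)
      qed
    qed
  qed
  then have "{\<sigma>. \<sigma> permutes {1..n} \<and> card {i \<in> {1..n}. \<sigma> i \<ge> i} = 1} \<subseteq> {\<tau>}" by blast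
  then have "card {\<sigma>. \<sigma> permutes {1..n} \<and> card {i \<in> {1..n}. \<sigma> i \<ge> i} = 1} \<le> card {\<tau>}"
    by (intro card_mono) auto
  then show ?thesis by (simp add: eulerian_number_def)
qed

lemma poly_eulerian_poly:
  "poly (eulerian_poly n) t =
     (\<Sum>\<sigma> | \<sigma> permutes {1..n}. t ^ card {i \<in> {1..n}. \<sigma> i \<ge> i})"
proof -
  let ?S = "{\<sigma>. \<sigma> permutes {1..n}}"
  let ?e = "\<lambda>\<sigma>. card {i \<in> {1..n}. \<sigma> i \<ge> i}"
  have e_le: "?e \<sigma> \<le> n" for \<sigma> :: "nat \<Rightarrow> nat"
  proof -
    have "?e \<sigma> \<le> card {1..n}" by (rule card_mono) auto
    then show ?thesis by simp
  qed
  have "poly (eulerian_poly n) t = (\<Sum>k\<le>n. \<Sum>\<sigma> | \<sigma> \<in> ?S \<and> ?e \<sigma> = k. t ^ ?e \<sigma>)"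
    by (simp add: eulerian_poly_def poly_sum poly_monom eulerian_number_def)
  also have "\<dots> = (\<Sum>\<sigma>\<in>?S. t ^ ?e \<sigma>)"
  proof (rule sum.group)
    show "?e ` ?S \<subseteq> {..n}" using e_le by blast
  qed (simp_all add: finite_permutations)
  finally show ?thesis .
qed

text \<open>
  Every \<open>i\<close> satisfies \<open>\<sigma> i \<ge> i\<close> or \<open>\<sigma> i \<le> i\<close>; in the second case \<open>\<sigma> i\<close> is a weak excedance of the
  inverse.
\<close>
lemma weak_excedances_permutation_and_inverse:
  fixes \<sigma> :: "nat \<Rightarrow> nat"
  assumes perm: "\<sigma> permutes {1..n}"
  shows "n \<le> card {i \<in> {1..n}. \<sigma> i \<ge> i} + card {i \<in> {1..n}. inv \<sigma> i \<ge> i}"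
proof -
  let ?A = "{i \<in> {1..n}. \<sigma> i \<ge> i}" and ?B = "{i \<in> {1..n}. inv \<sigma> i \<ge> i}"
  have "{1..n} \<subseteq> ?A \<union> inv \<sigma> ` ?B"
  proof
    fix i assume i: "i \<in> {1..n}"
    show "i \<in> ?A \<union> inv \<sigma> ` ?B"
    proof (cases "\<sigma> i \<ge> i")
      case True
      then show ?thesis using i by simp
    next
      case False
      have "\<sigma> i \<in> {1..n}" using permutes_in_image[OF perm] i by blast
      then have "\<sigma> i \<in> ?B" using False permutes_inverses(2)[OF perm] by simp
      moreover have "i = inv \<sigma> (\<sigma> i)" using permutes_inverses(2)[OF perm] by simp
      ultimately show ?thesis by blast
    qed
  qed
  then have "card {1..n} \<le> card (?A \<union> inv \<sigma> ` ?B)" by (intro card_mono) auto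
  also have "\<dots> \<le> card ?A + card (inv \<sigma> ` ?B)" by (rule card_Un_le)
  also have "\<dots> \<le> card ?A + card ?B" by (intro add_left_mono card_image_le) auto
  finally show ?thesis by simp
qed

text \<open>
  Averaging the terms of \<open>\<sigma>\<close> and of its inverse gives at least \<open>s ^ n\<close> for each of the \<open>n!\<close>
  permutations. The value is taken at \<open>s\<^sup>2\<close> so that the geometric mean is a power of \<open>s\<close>.
\<close>
lemma poly_eulerian_poly_ge:
  assumes s: "s \<ge> 1"
  shows "poly (eulerian_poly n) (s\<^sup>2) \<ge> fact n * s ^ n"
proof -
  let ?S = "{\<sigma>. \<sigma> permutes {1..n}}"
  let ?e = "\<lambda>\<sigma>. card {i \<in> {1..n}. \<sigma> i \<ge> i}"
  have "2 * poly (eulerian_poly n) (s\<^sup>2) = (\<Sum>\<sigma>\<in>?S. (s\<^sup>2) ^ ?e \<sigma> + (s\<^sup>2) ^ ?e (inv \<sigma>))"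
    unfolding poly_eulerian_poly sum.distrib
    using sum_permutations_inverse[of "\<lambda>\<sigma>. (s\<^sup>2) ^ ?e \<sigma>" "{1..n}"] by simp
  also have "\<dots> \<ge> (\<Sum>\<sigma>\<in>?S. 2 * s ^ n)"
  proof (rule sum_mono)
    fix \<sigma> assume "\<sigma> \<in> ?S"
    then have "s ^ n \<le> s ^ (?e \<sigma> + ?e (inv \<sigma>))"
      using weak_excedances_permutation_and_inverse[of \<sigma> n] s by (intro power_increasing) auto
    moreover have "2 * s ^ ?e \<sigma> * s ^ ?e (inv \<sigma>) \<le> (s ^ ?e \<sigma>)\<^sup>2 + (s ^ ?e (inv \<sigma>))\<^sup>2"
      by (rule sum_squares_bound)
    moreover have square: "(s\<^sup>2) ^ k = (s ^ k)\<^sup>2" for k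
      by (metis power_mult mult.commute)
    ultimately show "2 * s ^ n \<le> (s\<^sup>2) ^ ?e \<sigma> + (s\<^sup>2) ^ ?e (inv \<sigma>)"
      unfolding power_add square by linarith
  qed
  also have "(\<Sum>\<sigma>\<in>?S. 2 * s ^ n) = 2 * (fact n * s ^ n)"
    by (simp add: card_permutations)
  finally show ?thesis by simp
qed

section \<open>The image of the binomial power\<close>

lemma tendsto_binomial_times_fact_over_power:
  "(\<lambda>n. real (n choose j) * fact j / real n ^ j) \<longlonglongrightarrow> 1"
proof -
  have "(\<lambda>n. \<Prod>i<j. 1 - real i / real n) \<longlonglongrightarrow> (\<Prod>i<j. 1 - 0)"
    by (intro tendsto_prod tendsto_diff tendsto_const lim_const_over_n)
  moreover have "eventually (\<lambda>n. (\<Prod>i<j. 1 - real i / real n)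
      = real (n choose j) * fact j / real n ^ j) sequentially"
    using eventually_gt_at_top[of 0]
  proof eventually_elim
    case (elim n)
    have "(\<Prod>i<j. 1 - real i / real n) = (\<Prod>i<j. (real n - real i) / real n)"
      using elim by (intro prod.cong) (auto simp: field_simps)
    also have "\<dots> = (\<Prod>i<j. real n - real i) / real n ^ j"
      by (simp add: prod_dividef)
    also have "(\<Prod>i<j. real n - real i) = real (n choose j) * fact j"
      by (simp add: binomial_gbinomial gbinomial_prod_rev atLeast0LessThan)
    finally show ?case .
  qed
  ultimately show ?thesis by (simp add: tendsto_cong)
qed

lemma eulerian_op_binomial_power:
  "eulerian_op ([:1, c:] ^ n) =
     (\<Sum>j\<le>n. smult (real (n choose j) * c ^ j) (eulerian_poly j))"
proof -
  have "degree ([:1, c:] ^ n) \<le> n"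
    using degree_power_le[of "[:1, c:]" n] by (cases "c = 0") auto
  then show ?thesis
    by (simp add: eulerian_op_altdef coeff_linear_poly_power)
qed

theorem proposition2p1:
  fixes x :: real
  assumes "x > 0"
  shows "\<exists>N::nat. \<forall>n::nat. n \<ge> N \<and> n \<ge> 1 \<longrightarrow>
           \<not> real_rooted (eulerian_op ([:1, x / real n:] ^ n))"
proof -
  define s where "s = 1 + 1 / x"
  have s: "s \<ge> 1" "x * s \<ge> 1"
    using assms by (auto simp: s_def field_simps)
  obtain J :: nat where J: "exp (s\<^sup>2 * exp x) \<le> real J"
    using real_arch_simple by blast
  have "(\<lambda>n. \<Sum>j\<le>J. real (n choose j) * fact j / real n ^ j) \<longlonglongrightarrow> (\<Sum>j\<le>J. 1)"
    by (intro tendsto_sum tendsto_binomial_times_fact_over_power)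
  then have "eventually (\<lambda>n. (\<Sum>j\<le>J. real (n choose j) * fact j / real n ^ j) > real J) sequentially"
    by (rule order_tendstoD) simp
  then obtain N where N: "\<And>n. n \<ge> N \<Longrightarrow> (\<Sum>j\<le>J. real (n choose j) * fact j / real n ^ j) > real J"
    by (auto simp: eventually_sequentially)
  have "\<not> real_rooted (eulerian_op ([:1, x / real n:] ^ n))" if n: "n \<ge> max N J" "n \<ge> 1" for n
  proof
    define P where "P = eulerian_op ([:1, x / real n:] ^ n)"
    define b where "b = (\<lambda>j. real (n choose j) * (x / real n) ^ j)"
    assume "real_rooted (eulerian_op ([:1, x / real n:] ^ n))"
    then have rr: "real_rooted P" by (simp add: P_def)
    have P: "P = (\<Sum>j\<le>n. smult (b j) (eulerian_poly j))"
      by (simp add: P_def b_def eulerian_op_binomial_power)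
    have b: "b j \<ge> 0" for j using assms by (simp add: b_def)
    have coeff_P: "coeff P k = (\<Sum>j\<le>n. b j * coeff (eulerian_poly j) k)" for k
      by (simp add: P coeff_sum)
    have "coeff P 0 = (\<Sum>j\<le>n. if j = 0 then b j else 0)"
      unfolding coeff_P by (intro sum.cong) (auto simp: coeff_eulerian_poly eulerian_number_0)
    then have c0: "coeff P 0 = 1" by (simp add: b_def)
    have nonneg: "coeff P k \<ge> 0" for k
      unfolding coeff_P by (intro sum_nonneg mult_nonneg_nonneg b) (auto simp: coeff_eulerian_poly)
    have "coeff P 1 \<le> (\<Sum>j\<le>n. b j * 1)"
      unfolding coeff_P using eulerian_number_1_le
      by (intro sum_mono mult_left_mono b) (auto simp: coeff_eulerian_poly)
    also have "\<dots> = (1 + x / real n) ^ n"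
      by (subst add.commute, subst binomial_ring) (simp add: b_def)
    also have "\<dots> \<le> exp (x / real n) ^ n"
      using assms by (intro power_mono exp_ge_add_one_self) auto
    also have "\<dots> = exp x"
      using n by (simp flip: exp_of_nat_mult)
    finally have c1: "coeff P 1 \<le> exp x" .
    have "poly P (s\<^sup>2) \<le> exp (s\<^sup>2 * coeff P 1)"
      by (rule real_rooted_poly_le_exp[OF rr c0 nonneg]) simp
    also have "\<dots> \<le> exp (s\<^sup>2 * exp x)"
      using c1 by (simp add: mult_left_mono)
    finally have upper: "poly P (s\<^sup>2) \<le> real J" using J by simp
    have term_ge: "real (n choose j) * fact j / real n ^ j \<le> b j * poly (eulerian_poly j) (s\<^sup>2)" for j
    proof -
      have "real (n choose j) * fact j / real n ^ j * 1
          \<le> real (n choose j) * fact j / real n ^ j * (x * s) ^ j"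
        by (intro mult_left_mono one_le_power s) simp
      also have "\<dots> = b j * (fact j * s ^ j)"
        by (simp add: b_def power_mult_distrib power_divide)
      also have "\<dots> \<le> b j * poly (eulerian_poly j) (s\<^sup>2)"
        by (intro mult_left_mono poly_eulerian_poly_ge s b)
      finally show ?thesis by simp
    qed
    have "real J < (\<Sum>j\<le>J. real (n choose j) * fact j / real n ^ j)"
      using N n by simp
    also have "\<dots> \<le> (\<Sum>j\<le>n. real (n choose j) * fact j / real n ^ j)"
      by (rule sum_mono2) (use n in auto)
    also have "\<dots> \<le> (\<Sum>j\<le>n. b j * poly (eulerian_poly j) (s\<^sup>2))"
      by (intro sum_mono term_ge)
    also have "\<dots> = poly P (s\<^sup>2)"
      by (simp add: P poly_sum)
    finally show False using upper by simp
  qed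
  then show ?thesis by (intro exI[of _ "max N J"]) auto
qed

end
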